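(* Let $\mathcal{H}$ be a pseudohemisphere hypergraph on a finite totally ordered vertex set $V$ with $|V|=n\ge 2$. If every pair of vertices of $V$ is contained in some hyperedge $H\in\mathcal{H}$, then there exist at most $4$ hyperedges of $\mathcal{H}$ whose union is $V$.
   Context: A hypergraph $\mathcal{F}$ on a totally ordered finite vertex set $V$ (a family of subsets of $V$) is ABA-free if there are no two hyperedges $A,B\in\mathcal{F}$ and vertices $x<y<z$ with $x,z\in A\setminus B$ and $y\in B\setminus A$. For $F\subseteq V$ write $\bar F=V\setminus F$, and $\Delta$ denotes symmetric difference. A hypergraph $\mathcal{H}$ on $V$ is a pseudohemisphere hypergraph if there exist a set $X\subseteq V$ and an ABA-free hypergraph $\mathcal{F}$ on $V$ such that every hyperedge of $\mathcal{H}$ belongs to $\{F\Delta X,\ \bar F\Delta X : F\in\mathcal{F}\}$. *)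

theory Defs
  imports Main
begin

text \<open>The totally ordered vertex set is a subset \<open>V\<close> of a linearly ordered type, with the induced
  order.\<close>

definition hypergraph_on :: "'a set \<Rightarrow> 'a set set \<Rightarrow> bool" where
  "hypergraph_on V \<F> \<longleftrightarrow> (\<forall>F\<in>\<F>. F \<subseteq> V)"

definition ABA_free :: "'a::linorder set \<Rightarrow> 'a set set \<Rightarrow> bool" where
  "ABA_free V \<F> \<longleftrightarrow> hypergraph_on V \<F> \<and>
     \<not> (\<exists>A\<in>\<F>. \<exists>B\<in>\<F>. \<exists>x\<in>V. \<exists>y\<in>V. \<exists>z\<in>V.
          x < y \<and> y < z \<and> x \<in> A - B \<and> z \<in> A - B \<and> y \<in> B - A)"

definition pseudohemisphere :: "'a::linorder set \<Rightarrow> 'a set set \<Rightarrow> bool" where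
  "pseudohemisphere V \<H> \<longleftrightarrow> hypergraph_on V \<H> \<and>
     (\<exists>X \<F>. X \<subseteq> V \<and> ABA_free V \<F> \<and>
        (\<forall>H\<in>\<H>. \<exists>F\<in>\<F>. H = sym_diff F X \<or> H = sym_diff (V - F) X))"

end

theory Submission
  imports Defs
begin

text \<open>
  If no four hyperedges cover \<open>V\<close>, then any four members of the family \<open>\<G>\<close> of complements
  of hyperedges meet in \<open>V\<close>. We show that then two vertices hit all of \<open>\<G>\<close>, so that no
  hyperedge contains both of them.

  Think of the members of \<open>\<G>\<close> as hemispheres, of the vertices as points on the sphere, and of
  the order of the vertices as their order when seen from a base point. A Helly argument moves
  the base point into the intersection of all hemispheres, across one boundary at a time: if no
  crossing into a further hemisphere \<open>S\<close> is possible, then three hemispheres that already contain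
  the base point meet outside \<open>S\<close> only. Now reorient by the member \<open>G0\<close> of \<open>\<G>\<close> whose boundary is
  lowest at the left end. The traces of \<open>\<G>\<close> on \<open>G0\<close> then form an ABA-free family of pairwise
  intersecting sets, and such a family is hit by two neighbouring vertices of the upper hull.
\<close>

section \<open>Alternation-free families and their reorientation\<close>

text \<open>Positions are given by a map to the natural numbers, not by the order of the vertex
  type, because the argument repeatedly reorders the vertices.\<close>

definition alternation_free :: "('a \<Rightarrow> nat) \<Rightarrow> 'a set set \<Rightarrow> bool" where
  "alternation_free p \<F> \<longleftrightarrow>
     (\<forall>A\<in>\<F>. \<forall>B\<in>\<F>. \<forall>x\<in>A - B. \<forall>y\<in>B - A. \<forall>z\<in>A - B. \<not> (p x < p y \<and> p y < p z))"

text \<open>Set \<open>S\<close> stands for the vertices above a pseudoline, so the lower of two lines at the left end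
  is the one whose set contains the first vertex in which the two sets differ.\<close>

definition starts_below :: "('a \<Rightarrow> nat) \<Rightarrow> 'a set \<Rightarrow> 'a set \<Rightarrow> bool" where
  "starts_below p S A \<longleftrightarrow> (\<exists>x\<in>S - A. \<forall>y\<in>A - S. p x < p y)"

text \<open>Moves \<open>S\<close> behind all other vertices when \<open>N\<close> exceeds all positions.\<close>

definition shift :: "nat \<Rightarrow> 'a set \<Rightarrow> ('a \<Rightarrow> nat) \<Rightarrow> 'a \<Rightarrow> nat" where
  "shift N S p v = p v + (if v \<in> S then N else 0)"

lemma alternation_freeD:
  assumes "alternation_free p \<F>" "A \<in> \<F>" "B \<in> \<F>" "x \<in> A" "x \<notin> B" "y \<in> B" "y \<notin> A"
    "z \<in> A" "z \<notin> B" "p x < p y" "p y < p z"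
  shows False
  using assms unfolding alternation_free_def by blast

lemma alternation_free_mono: "alternation_free p \<F> \<Longrightarrow> \<G> \<subseteq> \<F> \<Longrightarrow> alternation_free p \<G>"
  unfolding alternation_free_def by blast

text \<open>Inside \<open>V\<close> complementation exchanges the two differences,
  \<open>(V - A) - (V - B) = B - A\<close>, so an alternation of complements is one of the original
  sets with swapped roles.\<close>

lemma alternation_free_complement:
  assumes "alternation_free p \<F>" "\<F> \<subseteq> Pow V"
  shows "alternation_free p ((-) V ` \<F>)"
proof -
  have "\<not> (p x < p y \<and> p y < p z)"
    if "A \<in> \<F>" "B \<in> \<F>" "x \<in> (V - A) - (V - B)" "y \<in> (V - B) - (V - A)" "z \<in> (V - A) - (V - B)"
    for A B x y z
    using alternation_freeD[OF assms(1) that(2,1), of x y z] that(3-5) by blast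
  then show ?thesis unfolding alternation_free_def by blast
qed

text \<open>An alternation needs vertices in both differences, and no member has a vertex outside
  \<open>V\<close>; so \<open>V\<close> cannot take part in one.\<close>

lemma alternation_free_insert:
  assumes "alternation_free p \<F>" "\<F> \<subseteq> Pow V"
  shows "alternation_free p (insert V \<F>)"
proof -
  have "\<not> (p x < p y \<and> p y < p z)"
    if "A \<in> insert V \<F>" "B \<in> insert V \<F>" "x \<in> A - B" "y \<in> B - A" "z \<in> A - B" for A B x y z
  proof -
    have "A \<in> \<F>" "B \<in> \<F>" using that assms(2) by auto
    then show ?thesis using alternation_freeD[OF assms(1), of A B x y z] that(3-5) by blast
  qed
  then show ?thesis unfolding alternation_free_def by blast
qed

lemma inj_on_shift:
  assumes "inj_on p V" "\<forall>v\<in>V. p v < N"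
  shows "inj_on (shift N S p) V"
proof (rule inj_onI)
  fix x y assume "x \<in> V" "y \<in> V" "shift N S p x = shift N S p y"
  moreover have "p x < N" "p y < N" using assms(2) \<open>x \<in> V\<close> \<open>y \<in> V\<close> by auto
  ultimately have "p x = p y" unfolding shift_def by (auto split: if_splits)
  then show "x = y" using assms(1) \<open>x \<in> V\<close> \<open>y \<in> V\<close> by (auto dest: inj_onD)
qed

text \<open>Taking \<open>S\<close> as the new line at infinity. An initial segment \<open>S\<close> rotates the vertex order, the
  moved vertices being replaced by their antipodes.\<close>

lemma alternation_free_switch:
  assumes aba: "alternation_free p \<F>" and sub: "\<F> \<subseteq> Pow V" "S \<subseteq> V"
    and sep: "\<And>F x y. F \<in> \<F> \<Longrightarrow> x \<in> S \<Longrightarrow> x \<notin> F \<Longrightarrow> y \<in> F \<Longrightarrow> y \<notin> S \<Longrightarrow> p x < p y"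
    and N: "\<forall>v\<in>V. p v < N"
  shows "alternation_free (shift N S p) ((\<lambda>F. sym_diff F S) ` \<F>)"
proof -
  have False
    if AB: "A \<in> \<F>" "B \<in> \<F>"
      and x: "x \<in> sym_diff A S" "x \<notin> sym_diff B S"
      and y: "y \<in> sym_diff B S" "y \<notin> sym_diff A S"
      and z: "z \<in> sym_diff A S" "z \<notin> sym_diff B S"
      and lt: "shift N S p x < shift N S p y" "shift N S p y < shift N S p z"
    for A B x y z
  proof -
    have "x \<in> V" "y \<in> V" "z \<in> V" using AB sub x y z by auto
    then have b: "p x < N" "p y < N" "p z < N" using N by auto
    \<comment> \<open>The shift puts \<open>S\<close> last, so along \<open>x\<close>,
      \<open>y\<close>, \<open>z\<close> membership in \<open>S\<close> can only switch on.\<close>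
    have 1: "x \<in> S \<Longrightarrow> y \<in> S" "y \<in> S \<Longrightarrow> z \<in> S"
      using lt b unfolding shift_def by (auto split: if_splits)
    \<comment> \<open>In the two mixed cases \<open>sep\<close> puts the vertices of
      \<open>S\<close> back in front, and the rotated triple alternates in the old order.\<close>
    consider "x \<in> S" "y \<in> S" "z \<in> S" | "x \<notin> S" "y \<in> S" "z \<in> S"
      | "x \<notin> S" "y \<notin> S" "z \<in> S" | "x \<notin> S" "y \<notin> S" "z \<notin> S"
      using 1 by blast
    then show False
    proof cases
      case 1
      then have "p x < p y" "p y < p z" using lt unfolding shift_def by auto
      then show ?thesis using alternation_freeD[OF aba AB(2,1), of x y z] 1 x y z by blast
    next
      case 2
      then have "p y < p z" using lt unfolding shift_def by auto
      moreover have "p z < p x" using sep[OF AB(1), of z x] 2 x z by blast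
      ultimately show ?thesis using alternation_freeD[OF aba AB(1,2), of y z x] 2 x y z by blast
    next
      case 3
      then have "p x < p y" using lt unfolding shift_def by auto
      moreover have "p z < p x" using sep[OF AB(1), of z x] 3 x z by blast
      ultimately show ?thesis using alternation_freeD[OF aba AB(2,1), of z x y] 3 x y z by blast
    next
      case 4
      then have "p x < p y" "p y < p z" using lt unfolding shift_def by auto
      then show ?thesis using alternation_freeD[OF aba AB, of x y z] 4 x y z by blast
    qed
  qed
  then show ?thesis unfolding alternation_free_def by blast
qed

section \<open>Comparing pseudolines at the left end\<close>

text \<open>Two pseudolines cross at most once: the vertex \<open>x0\<close> showing that
  \<open>S\<close> starts below \<open>A\<close> precedes \<open>y\<close>, so \<open>y\<close>
  before \<open>x\<close> would complete the alternation \<open>x0\<close>, \<open>y\<close>,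
  \<open>x\<close>.\<close>

lemma starts_below_separates:
  assumes aba: "alternation_free p \<F>" and AS: "A \<in> \<F>" "S \<in> \<F>" "\<F> \<subseteq> Pow V" and inj: "inj_on p V"
    and sb: "starts_below p S A" and xy: "x \<in> S" "x \<notin> A" "y \<in> A" "y \<notin> S"
  shows "p x < p y"
proof (rule ccontr)
  assume "\<not> p x < p y"
  moreover have "p x \<noteq> p y"
    using inj_onD[OF inj, of x y] AS xy by blast
  ultimately have "p y < p x" by simp
  moreover obtain x0 where "x0 \<in> S" "x0 \<notin> A" "p x0 < p y"
    using sb xy unfolding starts_below_def by blast
  ultimately show False using alternation_freeD[OF aba AS(2,1), of x0 y x] xy by blast
qed

text \<open>The comparison is lexicographic: the earlier of the two witnesses also serves for
  \<open>F\<close> and \<open>U\<close>.\<close>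

lemma starts_below_trans:
  assumes inj: "inj_on p V" and sub: "F \<subseteq> V" "S \<subseteq> V" "U \<subseteq> V"
    and FS: "starts_below p F S" and SU: "starts_below p S U"
  shows "starts_below p F U"
proof -
  obtain x where x: "x \<in> F" "x \<notin> S" "\<And>y. y \<in> S \<Longrightarrow> y \<notin> F \<Longrightarrow> p x < p y"
    using FS unfolding starts_below_def by blast
  obtain y where y: "y \<in> S" "y \<notin> U" "\<And>z. z \<in> U \<Longrightarrow> z \<notin> S \<Longrightarrow> p y < p z"
    using SU unfolding starts_below_def by blast
  have "p x \<noteq> p y" using inj_onD[OF inj, of x y] x y sub by blast
  then consider "p x < p y" | "p y < p x" by linarith
  then show ?thesis
  proof cases
    case 1
    then have "x \<notin> U" using y(3)[of x] x by fastforce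
    moreover have "p x < p z" if "z \<in> U" "z \<notin> F" for z
      using x(3)[of z] y(3)[of z] that 1 by fastforce
    ultimately show ?thesis unfolding starts_below_def using x by blast
  next
    case 2
    then have "y \<in> F" using x(3)[of y] y by fastforce
    moreover have "p y < p z" if "z \<in> U" "z \<notin> F" for z
      using x(3)[of z] y(3)[of z] that 2 by fastforce
    ultimately show ?thesis unfolding starts_below_def using y by blast
  qed
qed

text \<open>The first vertex of the symmetric difference, unique by injectivity, decides.\<close>

lemma starts_below_total:
  assumes inj: "inj_on p V" and fin: "finite V" and sub: "S \<subseteq> V" "A \<subseteq> V" and ne: "A \<noteq> S"
  shows "starts_below p S A \<or> starts_below p A S"
proof -
  let ?D = "sym_diff S A"
  have "?D \<subseteq> V" using sub by blast
  then have "finite (p ` ?D)" using fin finite_subset by blast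
  moreover have "p ` ?D \<noteq> {}" using ne by blast
  ultimately have "Min (p ` ?D) \<in> p ` ?D" by (rule Min_in)
  then obtain x where x: "x \<in> ?D" "p x = Min (p ` ?D)" by (rule imageE) simp
  have le: "p x \<le> p y" if "y \<in> ?D" for y
    using x(2) Min_le[OF \<open>finite (p ` ?D)\<close>, of "p y"] that by simp
  have lt: "p x < p y" if "y \<in> ?D" "y \<noteq> x" for y
  proof -
    have "p x \<noteq> p y" using inj_onD[OF inj, of x y] that x(1) sub by blast
    then show ?thesis using le[OF that(1)] by simp
  qed
  show ?thesis
  proof (cases "x \<in> S")
    case True
    then have "x \<in> S - A" using x(1) by blast
    moreover have "\<forall>y\<in>A - S. p x < p y" using lt True by blast
    ultimately show ?thesis unfolding starts_below_def by blast
  next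
    case False
    then have "x \<in> A - S" using x(1) by blast
    moreover have "\<forall>y\<in>S - A. p x < p y" using lt False by blast
    ultimately show ?thesis unfolding starts_below_def by blast
  qed
qed

lemma lowest_exists:
  assumes inj: "inj_on p V" and fin: "finite V" and sub: "\<B> \<subseteq> Pow V" and ne: "\<B> \<noteq> {}"
  shows "\<exists>T\<in>\<B>. \<forall>F\<in>\<B>. F \<noteq> T \<longrightarrow> starts_below p T F"
proof -
  have "finite \<B>" using fin sub by (meson finite_Pow_iff finite_subset)
  then show ?thesis using ne sub
  proof (induction \<B> rule: finite_ne_induct)
    case (singleton F)
    then show ?case by simp
  next
    case (insert F \<B>)
    then obtain T where T: "T \<in> \<B>" "\<forall>F\<in>\<B>. F \<noteq> T \<longrightarrow> starts_below p T F" by blast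
    have ne: "F \<noteq> T" using insert T by blast
    have FT: "F \<subseteq> V" "T \<subseteq> V" using insert T by auto
    show ?case
    proof (cases "starts_below p T F")
      case True
      then show ?thesis using T by blast
    next
      case False
      then have FbT: "starts_below p F T" using starts_below_total[OF inj fin FT] ne by blast
      have "starts_below p F U" if "U \<in> \<B>" for U
      proof (cases "U = T")
        case True
        then show ?thesis using FbT by simp
      next
        case False
        moreover have "U \<subseteq> V" using that insert.prems by auto
        ultimately show ?thesis using starts_below_trans[OF inj FT _ FbT] T that by blast
      qed
      then show ?thesis by blast
    qed
  qed
qed

section \<open>Crossing one boundary\<close>

lemma positions_bounded:
  assumes "finite V"
  obtains N :: nat where "\<forall>v\<in>V. p v < N"
proof -
  have "\<forall>v\<in>V. p v < Suc (Max (p ` V))" using assms by (simp add: le_imp_less_Suc)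
  then show thesis using that by blast
qed

text \<open>By \<open>wit\<close> there is a position \<open>c\<close> at which \<open>S\<close> lies below all of \<open>\<A>\<close>. After rotating the order to
  start at \<open>c\<close>, the lowest set at the start belongs to \<open>\<B>\<close> and can be switched.\<close>

lemma flip_exists:
  assumes fin: "finite V" and inj: "inj_on p V" and sub: "\<A> \<union> \<B> \<subseteq> Pow V"
    and aba: "alternation_free p (\<A> \<union> \<B>)" and S: "S \<in> \<B>" "S \<notin> \<A>"
    and wit: "\<And>A B. A \<in> \<A> \<Longrightarrow> B \<in> \<A> \<Longrightarrow> starts_below p S A \<Longrightarrow> starts_below p B S \<Longrightarrow>
      \<exists>w\<in>S. w \<notin> A \<and> w \<notin> B"
  shows "\<exists>T\<in>\<B>. \<exists>q. inj_on q V \<and> alternation_free q ((\<lambda>F. sym_diff F T) ` (\<A> \<union> \<B>))"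
proof -
  \<comment> \<open>The cut \<open>c\<close> goes just after the last of these vertices, or to 0 if
    there are none. From \<open>c\<close> on, a member that starts below \<open>S\<close> has no
    vertex outside \<open>S\<close>.\<close>
  let ?D = "\<Union>{B - S | B. B \<in> \<A> \<and> starts_below p B S}"
  have D: "finite ?D" using fin sub by (auto intro!: finite_subset[of ?D V])
  have SV: "S \<subseteq> V" using S sub by auto
  obtain c where c1: "\<And>B y. B \<in> \<A> \<Longrightarrow> starts_below p B S \<Longrightarrow> y \<in> B \<Longrightarrow> y \<notin> S \<Longrightarrow> p y < c"
    and c2: "\<And>A. A \<in> \<A> \<Longrightarrow> starts_below p S A \<Longrightarrow> \<exists>w\<in>S. w \<notin> A \<and> c \<le> p w"
  proof (cases "?D = {}")
    case True
    show ?thesis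
    proof (rule that[of 0])
      show "p y < 0" if "B \<in> \<A>" "starts_below p B S" "y \<in> B" "y \<notin> S" for B y
        using True that by blast
      show "\<exists>w\<in>S. w \<notin> A \<and> 0 \<le> p w" if "A \<in> \<A>" "starts_below p S A" for A
        using that unfolding starts_below_def by blast
    qed
  next
    case False
    then have "Max (p ` ?D) \<in> p ` ?D" using D by (intro Max_in) auto
    then obtain d B where d: "d \<in> B" "d \<notin> S" "B \<in> \<A>" "starts_below p B S" "p d = Max (p ` ?D)"
      by auto
    show ?thesis
    proof (rule that[of "Suc (p d)"])
      show "p y < Suc (p d)" if "B' \<in> \<A>" "starts_below p B' S" "y \<in> B'" "y \<notin> S" for B' y
      proof -
        have "y \<in> ?D" using that by blast
        then show ?thesis using D d(5) by (simp add: le_imp_less_Suc)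
      qed
      show "\<exists>w\<in>S. w \<notin> A \<and> Suc (p d) \<le> p w" if A: "A \<in> \<A>" "starts_below p S A" for A
      proof -
        \<comment> \<open>Since \<open>B\<close> starts below \<open>S\<close>, the vertex
          \<open>d\<close> of \<open>B - S\<close> precedes every vertex of \<open>S - B\<close>, in
          particular \<open>w\<close>.\<close>
        obtain w where w: "w \<in> S" "w \<notin> A" "w \<notin> B" using wit[OF A(1) d(3) A(2) d(4)] by blast
        have "p d < p w"
          using starts_below_separates[OF aba _ _ sub inj d(4) d(1,2) w(1,3)] S d(3) by blast
        then show ?thesis using w by auto
      qed
    qed
  qed
  obtain N where N: "\<forall>v\<in>V. p v < N" using positions_bounded[OF fin] by blast
  define C where "C = {v\<in>V. p v < c}"
  define q where "q = shift N C p"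
  let ?r = "\<lambda>F. sym_diff F C"
  have injq: "inj_on q V" unfolding q_def by (rule inj_on_shift[OF inj N])
  have CV: "C \<subseteq> V" unfolding C_def by blast
  have abaq: "alternation_free q (?r ` (\<A> \<union> \<B>))"
    unfolding q_def
  proof (rule alternation_free_switch[OF aba sub CV _ N])
    show "p x < p y" if "F \<in> \<A> \<union> \<B>" "x \<in> C" "x \<notin> F" "y \<in> F" "y \<notin> C" for F x y
      using that sub unfolding C_def by fastforce
  qed
  have subq: "?r ` (\<A> \<union> \<B>) \<subseteq> Pow V" using sub CV by auto
  \<comment> \<open>A member starting above \<open>S\<close> keeps its witness \<open>w\<close>
    beyond the cut. For one starting below, the witness \<open>b\<close> is rotated, which swaps its
    side, and by \<open>c1\<close> nothing unrotated precedes it on the wrong side.\<close>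
  have below: "starts_below q (?r S) (?r A)" if A: "A \<in> \<A>" for A
  proof -
    have AV: "A \<subseteq> V" using A sub by auto
    have "A \<noteq> S" using A S by blast
    then consider "starts_below p S A" | "starts_below p A S"
      using starts_below_total[OF inj fin SV AV] by blast
    then show ?thesis
    proof cases
      case 1
      obtain w where w: "w \<in> S" "w \<notin> A" "c \<le> p w" using c2[OF A 1] by blast
      have wC: "w \<notin> C" "w \<in> V" using w SV unfolding C_def by auto
      have "q w < q y" if y: "y \<in> ?r A" "y \<notin> ?r S" for y
      proof (cases "y \<in> C")
        case True
        then show ?thesis using wC N unfolding q_def shift_def by (simp add: trans_less_add2)
      next
        case False
        then have "y \<in> A" "y \<notin> S" using y by auto
        then have "p w < p y"
          using starts_below_separates[OF aba _ _ sub inj 1 w(1,2)] A S by blast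
        then show ?thesis using wC False unfolding q_def shift_def by simp
      qed
      then show ?thesis unfolding starts_below_def using w wC by blast
    next
      case 2
      obtain b where b: "b \<in> A" "b \<notin> S" "\<And>y. y \<in> S \<Longrightarrow> y \<notin> A \<Longrightarrow> p b < p y"
        using 2 unfolding starts_below_def by blast
      have bC: "b \<in> C" using c1[OF A 2 b(1,2)] b AV unfolding C_def by blast
      have "q b < q y" if y: "y \<in> ?r A" "y \<notin> ?r S" for y
      proof (cases "y \<in> C")
        case True
        then have "p b < p y" using y b(3)[of y] by blast
        then show ?thesis using bC True unfolding q_def shift_def by simp
      next
        case False
        then have "y \<in> A" "y \<notin> S" using y by auto
        then have "p y < c" "y \<in> V" using c1[OF A 2] AV by auto
        then show ?thesis using False unfolding C_def by blast
      qed
      then show ?thesis unfolding starts_below_def using b bC by blast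
    qed
  qed
  have subB: "?r ` \<B> \<subseteq> Pow V" using subq by blast
  have "?r ` \<B> \<noteq> {}" using S by blast
  from lowest_exists[OF injq fin subB this]
  obtain T' where T': "T' \<in> ?r ` \<B>" "\<forall>F\<in>?r ` \<B>. F \<noteq> T' \<longrightarrow> starts_below q T' F" ..
  from T'(1) obtain T where T: "T' = ?r T" "T \<in> \<B>" by (rule imageE)
  have T'V: "T' \<subseteq> V" using T'(1) subB by blast
  \<comment> \<open>\<open>T'\<close> is lowest among the images of \<open>\<B>\<close>, which
    include that of \<open>S\<close>; the latter lies below the images of
    \<open>\<A>\<close>.\<close>
  have lowest: "starts_below q T' F" if "F \<in> ?r ` (\<A> \<union> \<B>)" "F \<noteq> T'" for F
  proof (cases "F \<in> ?r ` \<B>")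
    case True
    from bspec[OF T'(2) this] that(2) show ?thesis ..
  next
    case False
    then have SF: "starts_below q (?r S) F" using below that(1) by blast
    have V: "?r S \<subseteq> V" "F \<subseteq> V" using that(1) subq SV CV by auto
    have "?r S \<in> ?r ` \<B>" using S by blast
    then consider "?r S = T'" | "starts_below q T' (?r S)" using T'(2) by blast
    then show ?thesis
    proof cases
      case 1
      then show ?thesis using SF by simp
    next
      case 2
      then show ?thesis by (rule starts_below_trans[OF injq T'V V _ SF])
    qed
  qed
  obtain M where M: "\<forall>v\<in>V. q v < M" using positions_bounded[OF fin] by blast
  have "alternation_free (shift M T' q) ((\<lambda>F. sym_diff F T') ` ?r ` (\<A> \<union> \<B>))"
  proof (rule alternation_free_switch[OF abaq subq T'V _ M])
    show "q x < q y" if F: "F \<in> ?r ` (\<A> \<union> \<B>)" and "x \<in> T'" "x \<notin> F" "y \<in> F" "y \<notin> T'" for F x y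
    proof (rule starts_below_separates[OF abaq F _ subq injq _ that(2-5)])
      show "T' \<in> ?r ` (\<A> \<union> \<B>)" using T'(1) by blast
      show "starts_below q T' F" by (rule lowest[OF F]) (use that in blast)
    qed
  qed
  \<comment> \<open>The rotation \<open>C\<close> occurs in both factors and cancels.\<close>
  moreover have "(\<lambda>F. sym_diff F T') ` ?r ` (\<A> \<union> \<B>) = (\<lambda>F. sym_diff F T) ` (\<A> \<union> \<B>)"
    unfolding image_image T(1) by (rule image_cong) auto
  moreover have "inj_on (shift M T' q) V" by (rule inj_on_shift[OF injq M])
  ultimately show ?thesis using T(2) by auto
qed

text \<open>If neither \<open>S\<close> nor its complement admits the flip, there are pairs with
  \<open>S \<subseteq> A1 \<union> B1\<close> and \<open>A2 \<inter> B2 \<subseteq> S\<close>.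
  Comparing \<open>A2\<close> with \<open>B1\<close> then leaves three members of
  \<open>\<A>\<close> that sandwich \<open>S\<close>.\<close>

lemma flip_exists_of_no_sandwich:
  assumes fin: "finite V" and inj: "inj_on p V" and sub: "\<A> \<union> \<B> \<subseteq> Pow V"
    and aba: "alternation_free p (\<A> \<union> \<B>)" and ne: "\<B> \<noteq> {}"
    and no: "\<And>A1 A2 A3 B. A1 \<in> \<A> \<Longrightarrow> A2 \<in> \<A> \<Longrightarrow> A3 \<in> \<A> \<Longrightarrow> B \<in> \<B> \<Longrightarrow>
      \<not> (A1 \<inter> A2 \<inter> A3 \<subseteq> B \<and> B \<subseteq> A1 \<union> A2 \<union> A3)"
  shows "\<exists>T\<in>\<B>. \<exists>q. inj_on q V \<and> alternation_free q ((\<lambda>F. sym_diff F T) ` (\<A> \<union> \<B>))"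
proof -
  obtain S where S: "S \<in> \<B>" using ne by blast
  have SA: "S \<notin> \<A>" using no[of S S S S] S by blast
  have SV: "S \<subseteq> V" using S sub by auto
  show ?thesis
  proof (cases "\<forall>A\<in>\<A>. \<forall>B\<in>\<A>. starts_below p S A \<longrightarrow> starts_below p B S \<longrightarrow> (\<exists>w\<in>S. w \<notin> A \<and> w \<notin> B)")
    case True
    show ?thesis by (rule flip_exists[OF fin inj sub aba S SA]) (use True in blast)
  next
    case False
    then obtain A1 B1 where 1: "A1 \<in> \<A>" "B1 \<in> \<A>" "starts_below p S A1" "starts_below p B1 S"
      "S \<subseteq> A1 \<union> B1" by blast
    show ?thesis
    proof (cases "\<forall>A\<in>\<A>. \<forall>B\<in>\<A>. starts_below p S A \<longrightarrow> starts_below p B S \<longrightarrow> (\<exists>v\<in>A \<inter> B. v \<notin> S)")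
      case True
      \<comment> \<open>Complementing turns the arrangement upside down: it reverses
        \<open>starts_below\<close> but leaves symmetric differences unchanged, so a flip for the
        complements is a flip for the original sets.\<close>
      let ?c = "(-) V"
      have compl: "?c ` \<A> \<union> ?c ` \<B> = ?c ` (\<A> \<union> \<B>)" by blast
      have rev: "starts_below p (V - F) (V - G) \<longleftrightarrow> starts_below p G F" if "F \<subseteq> V" "G \<subseteq> V" for F G
      proof -
        have "(V - F) - (V - G) = G - F" "(V - G) - (V - F) = F - G" using that by auto
        then show ?thesis unfolding starts_below_def by simp
      qed
      have "\<exists>T\<in>?c ` \<B>. \<exists>q. inj_on q V \<and>
        alternation_free q ((\<lambda>F. sym_diff F T) ` (?c ` \<A> \<union> ?c ` \<B>))"
      proof (rule flip_exists[OF fin inj])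
        show "?c ` \<A> \<union> ?c ` \<B> \<subseteq> Pow V" by blast
        show "alternation_free p (?c ` \<A> \<union> ?c ` \<B>)"
          unfolding compl by (rule alternation_free_complement[OF aba sub])
        show "V - S \<in> ?c ` \<B>" using S by blast
        show "V - S \<notin> ?c ` \<A>"
        proof
          assume "V - S \<in> ?c ` \<A>"
          then obtain A where "A \<in> \<A>" "V - S = V - A" by blast
          moreover from this have "A \<subseteq> V" using sub by auto
          ultimately have "A = S" using SV by blast
          then show False using SA \<open>A \<in> \<A>\<close> by simp
        qed
        show "\<exists>w\<in>V - S. w \<notin> A \<and> w \<notin> B"
          if "A \<in> ?c ` \<A>" "B \<in> ?c ` \<A>" "starts_below p (V - S) A" "starts_below p B (V - S)" for A B
        proof -
          from that(1,2) obtain A' B' where AB: "A' \<in> \<A>" "A = V - A'" "B' \<in> \<A>" "B = V - B'"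
            by blast
          have V: "A' \<subseteq> V" "B' \<subseteq> V" using AB sub by auto
          have "starts_below p A' S" "starts_below p S B'"
            using that(3,4) rev[OF SV V(1)] rev[OF V(2) SV] AB by auto
          then obtain v where "v \<in> A'" "v \<in> B'" "v \<notin> S" using True AB by blast
          then show ?thesis using AB V by blast
        qed
      qed
      then obtain T q where T: "T \<in> \<B>" "inj_on q V"
        "alternation_free q ((\<lambda>F. sym_diff F (V - T)) ` ?c ` (\<A> \<union> \<B>))"
        unfolding compl by blast
      have "(\<lambda>F. sym_diff F (V - T)) ` ?c ` (\<A> \<union> \<B>) = (\<lambda>F. sym_diff F T) ` (\<A> \<union> \<B>)"
        unfolding image_image
      proof (rule image_cong)
        fix F assume "F \<in> \<A> \<union> \<B>"
        then have "F \<subseteq> V" "T \<subseteq> V" using T sub by auto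
        then show "sym_diff (V - F) (V - T) = sym_diff F T" by blast
      qed simp
      then show ?thesis using T by auto
    next
      case False
      then obtain A2 B2 where 2: "A2 \<in> \<A>" "B2 \<in> \<A>" "starts_below p S A2" "starts_below p B2 S"
        "A2 \<inter> B2 \<subseteq> S" by blast
      \<comment> \<open>Otherwise \<open>w\<close> must precede \<open>v\<close> because
        \<open>S\<close> starts below \<open>A2\<close>, and follow it because \<open>B1\<close>
        starts below \<open>S\<close>.\<close>
      have "S \<subseteq> A2 \<union> B1 \<or> A2 \<inter> B1 \<subseteq> S"
      proof (rule ccontr)
        assume "\<not> ?thesis"
        then obtain v w where w: "w \<in> S" "w \<notin> A2" "w \<notin> B1" and v: "v \<in> A2" "v \<in> B1" "v \<notin> S" by blast
        have "p w < p v"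
          using starts_below_separates[OF aba _ _ sub inj 2(3) w(1,2) v(1,3)] 2 S by blast
        moreover have "p v < p w"
          using starts_below_separates[OF aba _ _ sub inj 1(4) v(2,3) w(1,3)] 1 S by blast
        ultimately show False by simp
      qed
      then have False
      proof
        assume "S \<subseteq> A2 \<union> B1"
        then show False using no[OF 2(1) 2(2) 1(2) S] 2(5) by blast
      next
        assume "A2 \<inter> B1 \<subseteq> S"
        then show False using no[OF 1(1) 2(1) 1(2) S] 1(5) by blast
      qed
      then show ?thesis ..
    qed
  qed
qed

section \<open>Orienting all hemispheres consistently\<close>

text \<open>\<open>\<M>\<close> holds the members recorded with reversed orientation, those not yet
  containing the base point. Each flip moves one out of \<open>\<M>\<close>, so induction on its
  size ends with none left.\<close>

lemma same_orientation_exists: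
  assumes fin: "finite V" and sub: "\<G> \<subseteq> Pow V"
    and meet: "\<And>A B C D. A \<in> \<G> \<Longrightarrow> B \<in> \<G> \<Longrightarrow> C \<in> \<G> \<Longrightarrow> D \<in> \<G> \<Longrightarrow> A \<inter> B \<inter> C \<inter> D \<noteq> {}"
    and "\<M> \<subseteq> \<G>" "X \<subseteq> V" "inj_on p V"
    and "alternation_free p ((\<lambda>G. sym_diff G X) ` (\<G> - \<M>) \<union> (\<lambda>G. V - sym_diff G X) ` \<M>)"
  shows "\<exists>q Y. Y \<subseteq> V \<and> inj_on q V \<and> alternation_free q ((\<lambda>G. sym_diff G Y) ` \<G>)"
  using assms(4-)
proof (induction "card \<M>" arbitrary: \<M> X p)
  case 0
  have "finite \<G>" using fin sub by (meson finite_Pow_iff finite_subset)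
  then have "\<M> = {}" using 0 finite_subset by fastforce
  then show ?case using 0 by auto
next
  case (Suc n)
  let ?A = "(\<lambda>G. sym_diff G X) ` (\<G> - \<M>)"
  let ?B = "(\<lambda>G. V - sym_diff G X) ` \<M>"
  have sub': "?A \<union> ?B \<subseteq> Pow V" using sub Suc.prems by auto
  have ne: "?B \<noteq> {}" using Suc.hyps(2) by auto
  have "\<exists>T\<in>?B. \<exists>q. inj_on q V \<and> alternation_free q ((\<lambda>F. sym_diff F T) ` (?A \<union> ?B))"
  proof (rule flip_exists_of_no_sandwich[OF fin Suc.prems(3) sub' Suc.prems(4) ne])
    fix A1 A2 A3 B assume "A1 \<in> ?A" "A2 \<in> ?A" "A3 \<in> ?A" "B \<in> ?B"
    then obtain G1 G2 G3 H where G: "G1 \<in> \<G>" "G2 \<in> \<G>" "G3 \<in> \<G>" "H \<in> \<M>"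
      and eq: "A1 = sym_diff G1 X" "A2 = sym_diff G2 X" "A3 = sym_diff G3 X" "B = V - sym_diff H X"
      by blast
    have H: "H \<in> \<G>" using G Suc.prems by blast
    obtain v where v: "v \<in> G1" "v \<in> G2" "v \<in> G3" "v \<in> H" using meet[OF G(1-3) H] by blast
    have "v \<in> V" using v H sub by blast
    \<comment> \<open>A common point \<open>v\<close> refutes the first inclusion if it is outside
      \<open>X\<close>, and the second if it is in \<open>X\<close>.\<close>
    then show "\<not> (A1 \<inter> A2 \<inter> A3 \<subseteq> B \<and> B \<subseteq> A1 \<union> A2 \<union> A3)"
      unfolding eq using v by (cases "v \<in> X") blast+
  qed
  then obtain H q where H: "H \<in> \<M>" and q: "inj_on q V"
    and aba: "alternation_free q ((\<lambda>F. sym_diff F (V - sym_diff H X)) ` (?A \<union> ?B))"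
    by blast
  \<comment> \<open>Relative to \<open>Y\<close> the member \<open>H\<close> becomes \<open>{}\<close> with reversed orientation, that is, \<open>V\<close>
    with the correct one.\<close>
  define Y where "Y = sym_diff X (V - sym_diff H X)"
  let ?M = "\<M> - {H}"
  let ?F = "(\<lambda>G. sym_diff G Y) ` (\<G> - ?M) \<union> (\<lambda>G. V - sym_diff G Y) ` ?M"
  have HV: "H \<subseteq> V" "X \<subseteq> V" using H Suc.prems sub by auto
  have "?F \<subseteq> insert V ((\<lambda>F. sym_diff F (V - sym_diff H X)) ` (?A \<union> ?B))" (is "_ \<subseteq> insert V ?F'")
  proof
    fix F assume "F \<in> ?F"
    then consider "F = sym_diff H Y" | G where "G \<in> \<G> - \<M>" "F = sym_diff G Y"
      | G where "G \<in> \<M>" "F = V - sym_diff G Y" by blast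
    then show "F \<in> insert V ?F'"
    proof cases
      case 1
      then have "F = V" using HV unfolding Y_def by blast
      then show ?thesis by simp
    next
      case 2
      have "F = sym_diff (sym_diff G X) (V - sym_diff H X)" unfolding 2 Y_def by blast
      then show ?thesis using 2(1) by blast
    next
      case 3
      have "G \<subseteq> V" using 3 Suc.prems sub by auto
      then have "F = sym_diff (V - sym_diff G X) (V - sym_diff H X)"
        unfolding 3 Y_def using HV by blast
      then show ?thesis using 3(1) by blast
    qed
  qed
  moreover have "alternation_free q (insert V ?F')"
  proof -
    have V: "?F' \<subseteq> Pow V" using sub' HV by auto
    show ?thesis by (rule alternation_free_insert[OF aba V])
  qed
  ultimately have "alternation_free q ?F" by (rule alternation_free_mono[rotated])
  moreover have "n = card ?M"
    using Suc.hyps(2) H by (simp add: card_Diff_singleton)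
  moreover have "Y \<subseteq> V" using HV unfolding Y_def by blast
  moreover have "?M \<subseteq> \<G>" using Suc.prems by blast
  ultimately show ?case using Suc.hyps(1)[of ?M Y q] q by blast
qed

section \<open>Unskipped vertices and hitting sets of size two\<close>

text \<open>The vertices skipped by no member play the role of the upper hull. The ground set
  \<open>W\<close> is a parameter because the induction deletes vertices.\<close>

definition skips :: "('a \<Rightarrow> nat) \<Rightarrow> 'a set \<Rightarrow> 'a set \<Rightarrow> 'a \<Rightarrow> bool" where
  "skips p W F v \<longleftrightarrow> v \<notin> F \<and> (\<exists>x\<in>F \<inter> W. \<exists>z\<in>F \<inter> W. p x < p v \<and> p v < p z)"

text \<open>Deleting a skipped vertex \<open>v\<close> creates no new unskipped vertex: a set that skips \<open>u\<close> only with
  the help of \<open>v\<close> can be replaced by the set that skips \<open>v\<close>.\<close>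

lemma unskipped_exists:
  assumes "finite W" "inj_on p W" "alternation_free p \<F>" "F \<in> \<F>" "F \<inter> W \<noteq> {}"
  shows "\<exists>u\<in>F \<inter> W. \<forall>A\<in>\<F>. \<not> skips p W A u"
  using assms
proof (induction "card W" arbitrary: W)
  case 0
  then show ?case by simp
next
  case (Suc n)
  show ?case
  proof (cases "\<exists>v\<in>W. \<exists>A\<in>\<F>. skips p W A v")
    case False
    then show ?thesis using Suc.prems by blast
  next
    case True
    then obtain v A where v: "v \<in> W" "A \<in> \<F>" "v \<notin> A" and "skips p W A v"
      unfolding skips_def by blast
    then obtain x0 z0 where xz: "x0 \<in> A" "x0 \<in> W" "z0 \<in> A" "z0 \<in> W" "p x0 < p v" "p v < p z0"
      unfolding skips_def by blast
    let ?W = "W - {v}"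
    \<comment> \<open>If \<open>v\<close> were the only vertex of \<open>F\<close> in
      \<open>W\<close>, then \<open>x0\<close>, \<open>v\<close>, \<open>z0\<close> would alternate
      between \<open>A\<close> and \<open>F\<close>.\<close>
    have F: "F \<inter> ?W \<noteq> {}"
    proof
      assume "F \<inter> ?W = {}"
      then have "v \<in> F" "x0 \<notin> F" "z0 \<notin> F" using Suc.prems(5) xz v by auto
      then show False using alternation_freeD[OF Suc.prems(3) v(2) Suc.prems(4), of x0 v z0] xz v by blast
    qed
    have "n = card ?W" using Suc v by (simp add: card_Diff_singleton)
    moreover have "inj_on p ?W" using Suc.prems(2) by (rule inj_on_subset) blast
    ultimately obtain u where u: "u \<in> F" "u \<in> W" "u \<noteq> v" and unsk: "\<And>B. B \<in> \<F> \<Longrightarrow> \<not> skips p ?W B u"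
      using Suc.hyps(1)[of ?W] Suc.prems F by blast
    have "\<not> skips p W B u" if B: "B \<in> \<F>" for B
    proof
      assume "skips p W B u"
      then obtain x z where w: "u \<notin> B" "x \<in> B" "x \<in> W" "z \<in> B" "z \<in> W" "p x < p u" "p u < p z"
        unfolding skips_def by blast
      have pos: "p s \<noteq> p t" if "s \<in> W" "t \<in> W" "s \<noteq> t" for s t
        using inj_onD[OF Suc.prems(2)] that by blast
      \<comment> \<open>\<open>B\<close> does not skip \<open>u\<close> without \<open>v\<close>, so
        \<open>v\<close> is its only vertex on one side of \<open>u\<close>.\<close>
      consider "x = v" "\<forall>t\<in>B \<inter> ?W. \<not> p t < p u" | "z = v" "\<forall>t\<in>B \<inter> ?W. \<not> p u < p t"
        using unsk[OF B] w unfolding skips_def by blast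
      then show False
      proof cases
        case 1
        have "x0 \<notin> B"
        proof
          assume "x0 \<in> B"
          then have "\<not> p x0 < p u" using 1(2) xz v(3) by blast
          then show False using xz(5) w(6) 1(1) by simp
        qed
        \<comment> \<open>As \<open>B\<close> contains \<open>v\<close> but not \<open>x0\<close>,
          it contains all of \<open>A\<close> to the right of \<open>v\<close>. Hence
          \<open>u\<close> is not in \<open>A\<close> and \<open>z0\<close> lies beyond
          \<open>u\<close>, so \<open>A\<close> skips \<open>u\<close> even without
          \<open>v\<close>.\<close>
        then have no: "t \<in> B" if "t \<in> A" "p v < p t" for t
          using alternation_freeD[OF Suc.prems(3) v(2) B, of x0 v t] that xz v w 1 by blast
        have "z0 \<in> B" using no xz by blast
        then have "\<not> p z0 < p u" using 1(2) xz v(3) by blast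
        moreover have "z0 \<noteq> u" using w(1) \<open>z0 \<in> B\<close> by blast
        ultimately have "p u < p z0" using pos[of z0 u] xz u by fastforce
        moreover have "u \<notin> A" using no[of u] w(1,6) 1(1) by blast
        moreover have "p x0 < p u" using xz(5) w(6) 1(1) by simp
        moreover have "x0 \<in> A \<inter> ?W" "z0 \<in> A \<inter> ?W" using xz v(3) by auto
        ultimately have "skips p ?W A u" unfolding skips_def by blast
        then show False using unsk v by blast
      next
        case 2
        have "z0 \<notin> B"
        proof
          assume "z0 \<in> B"
          then have "\<not> p u < p z0" using 2(2) xz v(3) by blast
          then show False using xz(6) w(7) 2(1) by simp
        qed
        then have no: "t \<in> B" if "t \<in> A" "p t < p v" for t
          using alternation_freeD[OF Suc.prems(3) v(2) B, of t v z0] that xz v w 2 by blast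
        have "x0 \<in> B" using no xz by blast
        then have "\<not> p u < p x0" using 2(2) xz v(3) by blast
        moreover have "x0 \<noteq> u" using w(1) \<open>x0 \<in> B\<close> by blast
        ultimately have "p x0 < p u" using pos[of x0 u] xz u by fastforce
        moreover have "u \<notin> A" using no[of u] w(1,7) 2(1) by blast
        moreover have "p u < p z0" using xz(6) w(7) 2(1) by simp
        moreover have "x0 \<in> A \<inter> ?W" "z0 \<in> A \<inter> ?W" using xz v(3) by auto
        ultimately have "skips p ?W A u" unfolding skips_def by blast
        then show False using unsk v by blast
      qed
    qed
    then show ?thesis using u by blast
  qed
qed

text \<open>On the unskipped vertices \<open>U\<close> each member traces an interval. Take
  \<open>r\<close> as the leftmost right end and \<open>l\<close> as the rightmost left end; an
  interval missing both would lie strictly between them, separating \<open>R\<close> from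
  \<open>L\<close>.\<close>

lemma two_points_hit:
  assumes fin: "finite V" and inj: "inj_on p V" and sub: "\<F> \<subseteq> Pow V"
    and aba: "alternation_free p \<F>" and ne: "\<F> \<noteq> {}"
    and meet: "\<And>A B. A \<in> \<F> \<Longrightarrow> B \<in> \<F> \<Longrightarrow> A \<inter> B \<noteq> {}"
  shows "\<exists>x\<in>V. \<exists>y\<in>V. \<forall>F\<in>\<F>. x \<in> F \<or> y \<in> F"
proof -
  define U where "U = {u\<in>V. \<forall>A\<in>\<F>. \<not> skips p V A u}"
  have finF: "finite \<F>" using fin sub by (meson finite_Pow_iff finite_subset)
  have U: "F \<inter> U \<noteq> {}" "finite (F \<inter> U)" if "F \<in> \<F>" for F
  proof -
    have "F \<subseteq> V" "F \<noteq> {}" using that sub meet[OF that that] by auto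
    then show "F \<inter> U \<noteq> {}"
      using unskipped_exists[OF fin inj aba that] unfolding U_def by blast
    show "finite (F \<inter> U)" using fin unfolding U_def by simp
  qed
  have between: "u \<in> A" if "A \<in> \<F>" "u \<in> U" "x \<in> A" "z \<in> A" "p x < p u" "p u < p z" for A u x z
    using that sub unfolding U_def skips_def by blast
  let ?max = "\<lambda>F. Max (p ` (F \<inter> U))" and ?min = "\<lambda>F. Min (p ` (F \<inter> U))"
  have ext: "\<exists>h\<in>F \<inter> U. p h = ?max F" "\<exists>h\<in>F \<inter> U. p h = ?min F" if "F \<in> \<F>" for F
  proof -
    have "finite (p ` (F \<inter> U))" "p ` (F \<inter> U) \<noteq> {}" using U[OF that] by auto
    from Max_in[OF this] Min_in[OF this]
    show "\<exists>h\<in>F \<inter> U. p h = ?max F" "\<exists>h\<in>F \<inter> U. p h = ?min F" by (metis imageE)+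
  qed
  have bounds: "?min F \<le> p h" "p h \<le> ?max F" if "F \<in> \<F>" "h \<in> F" "h \<in> U" for F h
    using U[OF that(1)] that by auto
  have "Min (?max ` \<F>) \<in> ?max ` \<F>" "Max (?min ` \<F>) \<in> ?min ` \<F>"
    using finF ne by (auto intro!: Min_in Max_in)
  then obtain R L where RL: "R \<in> \<F>" "?max R = Min (?max ` \<F>)" "L \<in> \<F>" "?min L = Max (?min ` \<F>)"
    by (smt (verit) imageE)
  obtain r l where r: "r \<in> R" "r \<in> U" "p r = ?max R" and l: "l \<in> L" "l \<in> U" "p l = ?min L"
    using ext RL by (metis IntE)
  have hit: "r \<in> F \<or> l \<in> F" if F: "F \<in> \<F>" for F
  proof (rule ccontr)
    assume n: "\<not> ?thesis"
    obtain h g where h: "h \<in> F" "h \<in> U" "p h = ?max F" and g: "g \<in> F" "g \<in> U" "p g = ?min F"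
      using ext[OF F] by blast
    have pos: "p s \<noteq> p t" if "s \<in> V" "t \<in> V" "s \<noteq> t" for s t
      using inj_onD[OF inj] that by blast
    have UV: "U \<subseteq> V" unfolding U_def by blast
    have "p r \<le> p h" using F finF RL r h by (simp add: Min_le)
    then have rh: "p r < p h" using pos[of r h] n h r UV by fastforce
    have "p g \<le> p l" using F finF RL l g by (simp add: Max_ge)
    then have gl: "p g < p l" using pos[of g l] n g l UV by fastforce
    have hl: "p h < p l"
    proof (rule ccontr)
      assume "\<not> p h < p l"
      then have "p l < p h" using pos[of h l] n h l UV by fastforce
      then show False using between[OF F l(2) g(1) h(1) gl] n by blast
    qed
    have hR: "h \<notin> R" using bounds(2)[OF RL(1), of h] h rh r by fastforce
    have hL: "h \<notin> L" using bounds(1)[OF RL(3), of h] h hl l by fastforce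
    \<comment> \<open>The common vertex need not be in \<open>U\<close>; on either side of
      \<open>h\<close> it makes \<open>L\<close> or \<open>R\<close> skip the unskipped vertex
      \<open>h\<close>.\<close>
    obtain v where v: "v \<in> R" "v \<in> L" using meet[OF RL(1,3)] by blast
    have "v \<in> V" using v RL sub by blast
    then have "p v \<noteq> p h" using pos[of v h] hR v h UV by blast
    then consider "p v < p h" | "p h < p v" by linarith
    then show False
    proof cases
      case 1
      then show ?thesis using between[OF RL(3) h(2) v(2) l(1) 1 hl] hL by blast
    next
      case 2
      then show ?thesis using between[OF RL(1) h(2) r(1) v(1) rh 2] hR by blast
    qed
  qed
  then show ?thesis using r l unfolding U_def by blast
qed

section \<open>Two vertices hitting all hemispheres\<close>

lemma two_points_hit_hemispheres:
  assumes fin: "finite V" and sub: "\<G> \<subseteq> Pow V" and ne: "\<G> \<noteq> {}"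
    and meet: "\<And>A B C D. A \<in> \<G> \<Longrightarrow> B \<in> \<G> \<Longrightarrow> C \<in> \<G> \<Longrightarrow> D \<in> \<G> \<Longrightarrow> A \<inter> B \<inter> C \<inter> D \<noteq> {}"
    and "\<M> \<subseteq> \<G>" "X \<subseteq> V" "inj_on p V"
    and "alternation_free p ((\<lambda>G. sym_diff G X) ` (\<G> - \<M>) \<union> (\<lambda>G. V - sym_diff G X) ` \<M>)"
  shows "\<exists>x\<in>V. \<exists>y\<in>V. \<forall>G\<in>\<G>. x \<in> G \<or> y \<in> G"
proof -
  obtain q Y where Y: "Y \<subseteq> V" and q: "inj_on q V"
    and aba: "alternation_free q ((\<lambda>G. sym_diff G Y) ` \<G>)"
    using same_orientation_exists[OF fin sub meet assms(5-8)] by blast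
  let ?F = "(\<lambda>G. sym_diff G Y) ` \<G>"
  have subF: "?F \<subseteq> Pow V" using sub Y by auto
  have "?F \<noteq> {}" using ne by blast
  from lowest_exists[OF q fin subF this]
  obtain T where T: "T \<in> ?F" "\<forall>F\<in>?F. F \<noteq> T \<longrightarrow> starts_below q T F" ..
  from T(1) obtain G0 where G0: "T = sym_diff G0 Y" "G0 \<in> \<G>" by (rule imageE)
  have TV: "T \<subseteq> V" using T(1) subF by blast
  obtain N where N: "\<forall>v\<in>V. q v < N" using positions_bounded[OF fin] by blast
  have abaT: "alternation_free (shift N T q) ((\<lambda>F. sym_diff F T) ` ?F)"
  proof (rule alternation_free_switch[OF aba subF TV _ N])
    show "q x < q y" if F: "F \<in> ?F" and "x \<in> T" "x \<notin> F" "y \<in> F" "y \<notin> T" for F x y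
    proof (rule starts_below_separates[OF aba F T(1) subF q _ that(2-5)])
      have "F \<noteq> T" using that by blast
      with bspec[OF T(2) F] show "starts_below q T F" ..
    qed
  qed
  \<comment> \<open>Switching at \<open>T\<close> cancels \<open>Y\<close>, leaving
    \<open>G0\<close> as the only reorientation.\<close>
  have "(\<lambda>F. sym_diff F T) ` ?F = (\<lambda>G. sym_diff G G0) ` \<G>"
    unfolding image_image G0(1) by (rule image_cong) auto
  with abaT have abaG: "alternation_free (shift N T q) ((\<lambda>G. sym_diff G G0) ` \<G>)" by simp
  have aba0: "alternation_free (shift N T q) ((\<lambda>G. G \<inter> G0) ` \<G>)"
  proof -
    have "\<not> (shift N T q x < shift N T q y \<and> shift N T q y < shift N T q z)"
      if "A \<in> \<G>" "B \<in> \<G>" "x \<in> A \<inter> G0 - B \<inter> G0" "y \<in> B \<inter> G0 - A \<inter> G0" "z \<in> A \<inter> G0 - B \<inter> G0"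
      for A B x y z
      \<comment> \<open>Inside \<open>G0\<close> symmetric difference with \<open>G0\<close> is
        complementation, so the roles of \<open>A\<close> and \<open>B\<close> are
        exchanged.\<close>
      using alternation_freeD[OF abaG imageI[OF that(2)] imageI[OF that(1)], of x y z] that(3-5)
      by blast
    then show ?thesis unfolding alternation_free_def by blast
  qed
  have "\<exists>x\<in>V. \<exists>y\<in>V. \<forall>F\<in>(\<lambda>G. G \<inter> G0) ` \<G>. x \<in> F \<or> y \<in> F"
  proof (rule two_points_hit[OF fin inj_on_shift[OF q N] _ aba0])
    show "(\<lambda>G. G \<inter> G0) ` \<G> \<subseteq> Pow V" using sub by auto
    show "(\<lambda>G. G \<inter> G0) ` \<G> \<noteq> {}" using ne by blast
    show "A \<inter> B \<noteq> {}" if "A \<in> (\<lambda>G. G \<inter> G0) ` \<G>" "B \<in> (\<lambda>G. G \<inter> G0) ` \<G>" for A B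
    proof -
      from that obtain A' B' where "A' \<in> \<G>" "A = A' \<inter> G0" "B' \<in> \<G>" "B = B' \<inter> G0" by blast
      then show ?thesis using meet[of A' B' G0 G0] G0 by auto
    qed
  qed
  then show ?thesis by auto
qed

section \<open>From hyperedges to hemispheres\<close>

lemma rank_strict_mono:
  fixes V :: "'a::linorder set"
  assumes "finite V" "x \<in> V" "x < y"
  shows "card {w\<in>V. w < x} < card {w\<in>V. w < y}"
  by (rule psubset_card_mono) (use assms in auto)

theorem mainTheorem7:
  fixes V :: "'a::linorder set" and \<H> :: "'a set set"
  assumes "finite V" and "card V \<ge> 2"
    and "pseudohemisphere V \<H>"
    and "\<And>x y. x \<in> V \<Longrightarrow> y \<in> V \<Longrightarrow> x \<noteq> y \<Longrightarrow> \<exists>H\<in>\<H>. x \<in> H \<and> y \<in> H"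
  shows "\<exists>\<C>. \<C> \<subseteq> \<H> \<and> finite \<C> \<and> card \<C> \<le> 4 \<and> \<Union>\<C> = V"
proof (rule ccontr)
  assume no: "\<not> ?thesis"
  have HV: "H \<subseteq> V" if "H \<in> \<H>" for H
    using assms(3) that unfolding pseudohemisphere_def hypergraph_on_def by blast
  from assms(3) obtain X \<F> where X: "X \<subseteq> V" and \<F>: "ABA_free V \<F>"
    and rep: "\<forall>H\<in>\<H>. \<exists>F\<in>\<F>. H = sym_diff F X \<or> H = sym_diff (V - F) X"
    unfolding pseudohemisphere_def by (elim exE conjE) (rule that)
  have FV: "F \<subseteq> V" if "F \<in> \<F>" for F
    using \<F> that unfolding ABA_free_def hypergraph_on_def by blast
  have other: "\<exists>y\<in>V. y \<noteq> x" for x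
  proof (rule ccontr)
    assume "\<not> ?thesis"
    then have "V \<subseteq> {x}" by blast
    then have "card V \<le> 1" using card_mono[of "{x}" V] by simp
    then show False using assms(2) by simp
  qed
  define p where "p v = card {w\<in>V. w < v}" for v
  have mono: "p x < p y" if "x \<in> V" "x < y" for x y
    unfolding p_def by (rule rank_strict_mono[OF assms(1) that])
  have inj: "inj_on p V"
    by (rule inj_onI) (metis mono less_irrefl neqE)
  have lt: "x < y" if "x \<in> V" "y \<in> V" "p x < p y" for x y
    using mono[of y x] that by (metis less_asym neqE)
  have abaF: "alternation_free p \<F>"
  proof -
    have "\<not> (p x < p y \<and> p y < p z)"
      if "A \<in> \<F>" "B \<in> \<F>" "x \<in> A - B" "y \<in> B - A" "z \<in> A - B" for A B x y z
    proof -
      have "x \<in> V" "y \<in> V" "z \<in> V" using FV that by auto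
      then show ?thesis using \<F> that lt unfolding ABA_free_def by blast
    qed
    then show ?thesis unfolding alternation_free_def by blast
  qed
  define \<G> where "\<G> = (-) V ` \<H>"
  \<comment> \<open>A hyperedge \<open>sym_diff F X\<close> has its complement in
    \<open>\<M>\<close>; one of the form \<open>sym_diff (V - F) X\<close> has a complement
    \<open>G\<close> with \<open>sym_diff G X = F\<close>.\<close>
  define \<M> where "\<M> = {G\<in>\<G>. V - sym_diff G X \<in> \<F>}"
  have "sym_diff G X \<in> \<F>" if "G \<in> \<G> - \<M>" for G
  proof -
    from that obtain H where H: "H \<in> \<H>" "G = V - H" unfolding \<G>_def by blast
    obtain F where F: "F \<in> \<F>" "H = sym_diff F X \<or> H = sym_diff (V - F) X" using bspec[OF rep H(1)] ..
    have "V - sym_diff G X = F \<or> sym_diff G X = F"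
      using F(2) H(2) X FV[OF F(1)] by blast
    then show ?thesis using that F(1) unfolding \<M>_def by auto
  qed
  then have aba: "alternation_free p ((\<lambda>G. sym_diff G X) ` (\<G> - \<M>) \<union> (\<lambda>G. V - sym_diff G X) ` \<M>)"
    by (intro alternation_free_mono[OF abaF]) (auto simp: \<M>_def)
  have "\<exists>x\<in>V. \<exists>y\<in>V. \<forall>G\<in>\<G>. x \<in> G \<or> y \<in> G"
  proof (rule two_points_hit_hemispheres[OF assms(1) _ _ _ _ X inj aba])
    show "\<G> \<subseteq> Pow V" "\<M> \<subseteq> \<G>" unfolding \<G>_def \<M>_def by auto
    show "\<G> \<noteq> {}"
      using assms(4) other unfolding \<G>_def by blast
    show "A \<inter> B \<inter> C \<inter> D \<noteq> {}" if "A \<in> \<G>" "B \<in> \<G>" "C \<in> \<G>" "D \<in> \<G>" for A B C D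
    proof -
      note G = that[unfolded \<G>_def]
      from G(1) obtain HA where HA: "A = V - HA" "HA \<in> \<H>" by (rule imageE)
      from G(2) obtain HB where HB: "B = V - HB" "HB \<in> \<H>" by (rule imageE)
      from G(3) obtain HC where HC: "C = V - HC" "HC \<in> \<H>" by (rule imageE)
      from G(4) obtain HD where HD: "D = V - HD" "HD \<in> \<H>" by (rule imageE)
      have "card {HA, HB, HC, HD} \<le> 4"
        using card_length[of "[HA, HB, HC, HD]"] by simp
      moreover have "{HA, HB, HC, HD} \<subseteq> \<H>" "finite {HA, HB, HC, HD}" using HA HB HC HD by auto
      ultimately have "\<Union>{HA, HB, HC, HD} \<noteq> V" using no by blast
      moreover have "\<Union>{HA, HB, HC, HD} \<subseteq> V" using HV HA(2) HB(2) HC(2) HD(2) by auto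
      ultimately obtain v where "v \<in> V" "v \<notin> HA" "v \<notin> HB" "v \<notin> HC" "v \<notin> HD" by auto
      then show ?thesis using HA(1) HB(1) HC(1) HD(1) by blast
    qed
  qed
  then obtain x y where xy: "x \<in> V" "y \<in> V" and hit: "\<forall>G\<in>\<G>. x \<in> G \<or> y \<in> G" by blast
  have miss: "x \<notin> H \<or> y \<notin> H" if "H \<in> \<H>" for H
    using hit that unfolding \<G>_def by auto
  obtain z where "z \<in> V" "z \<noteq> x" using other by blast
  show False
  \<comment> \<open>The hitting pair may coincide; then \<open>x\<close> is in no hyperedge, and a
    second vertex \<open>z\<close> gives the contradiction.\<close>
  proof (cases "x = y")
    case True
    then show ?thesis using assms(4)[OF xy(1) \<open>z \<in> V\<close>] \<open>z \<noteq> x\<close> miss by blast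
  next
    case False
    then show ?thesis using assms(4)[OF xy(1,2)] miss by blast
  qed
qed

end
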